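(* Let $n\ge 2$, let $0\le p\le 1$, and let $\rho_1=(1-p)\,\mathbb{1}_2/2+p\,|\psi\rangle\langle\psi|$, where $|\psi\rangle=\cos(\theta_1/2)|0\rangle+e^{i\varphi_1}\sin(\theta_1/2)|1\rangle$ with $\theta_1\in[0,\pi]$, $\varphi_1\in[0,2\pi]$ is an arbitrary pure qubit state. Consider the $n$-qubit initial state $\rho=\rho_1\otimes|0\rangle\langle 0|^{\otimes (n-1)}$. Let $\hat{\mathbf u}\in\mathbb{R}^3$ be a unit vector and $\alpha\in\mathbb{R}$ such that the rotation of $\mathbb{R}^3$ about the axis $\hat{\mathbf u}$ by the angle $\alpha$ maps the unit vector $\mathbf e_z$ to a vector not lying on the $z$-axis, and put $$U=W_{\mathrm{sync},n}\,C_{12}C_{13}\cdots C_{1n},\qquad W_{\mathrm{sync},n}=R_{\hat{\mathbf u}}(\alpha)^{\otimes n}.$$ Let $\rho'=U\rho U^\dagger$ and let $\rho_i'$ be the reduced state of qubit $i$ of $\rho'$. Then, except when $\theta_1=\pi/2$ or $p=0$ (in which cases the reduced states are maximally mixed and the phases are undefined), the phases of all qubits are defined and perfectly synchronized: $$f(\rho_1',\rho_i')=1\qquad\text{for all } i\in\{2,\dots,n\}.$$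
   Context: Qubits have computational basis $\{|0\rangle,|1\rangle\}$; $\boldsymbol\sigma=(\sigma_x,\sigma_y,\sigma_z)$ is the vector of Pauli matrices. $C_{ij}$ denotes the CNOT gate with qubit $i$ as control and qubit $j$ as target (it flips qubit $j$ in the computational basis iff qubit $i$ is $|1\rangle$). For a unit vector $\hat{\mathbf u}\in\mathbb{R}^3$, $R_{\hat{\mathbf u}}(\alpha)=e^{-i\frac{\alpha}{2}\hat{\mathbf u}\cdot\boldsymbol\sigma}$. The Bloch vector of a qubit density matrix $\rho$ is $\mathbf n=\operatorname{tr}(\boldsymbol\sigma\rho)=(n_x,n_y,n_z)$, so that $\rho=(\mathbb{1}+\mathbf n\cdot\boldsymbol\sigma)/2$; let $\mathbf m=(n_x,n_y)$. The phase of a qubit is defined iff $\mathbf m\neq 0$. The quantum-phase fidelity of two qubit states $\rho_1,\rho_2$ with $\mathbf m_1\ne0$ and $\mathbf m_2\neq0$ is $f(\rho_1,\rho_2)=\dfrac{\mathbf m_1\cdot\mathbf m_2}{\|\mathbf m_1\|\,\|\mathbf m_2\|}$; if $\mathbf m_1=0$ or $\mathbf m_2=0$ it is undefined. *)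

theory Defs
  imports
    "HOL-Analysis.Analysis"
    "Jordan_Normal_Form.Matrix"
    "Jordan_Normal_Form.Schur_Decomposition"
begin

text \<open>
  Operators on \<open>n\<close> qubits are complex matrices of dimension \<open>2^n\<close>. Qubits are numbered
  \<open>1, \<dots>, n\<close>, and qubit \<open>1\<close> is the leftmost tensor factor. Hence the computational basis state
  with index \<open>k < 2^n\<close> has qubit \<open>i\<close> in the state given by the binary digit of \<open>k\<close> at position
  \<open>n - i\<close>.
\<close>

no_notation vec_index (infixl "$" 100)

definition tensor_mat :: "complex mat \<Rightarrow> complex mat \<Rightarrow> complex mat" where
  "tensor_mat A B = Matrix.mat (dim_row A * dim_row B) (dim_col A * dim_col B)
     (\<lambda>(r, c). A $$ (r div dim_row B, c div dim_col B) * B $$ (r mod dim_row B, c mod dim_col B))"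

fun tensor_pow :: "complex mat \<Rightarrow> nat \<Rightarrow> complex mat" where
  "tensor_pow A 0 = 1\<^sub>m 1"
| "tensor_pow A (Suc n) = tensor_mat A (tensor_pow A n)"

definition mat_trace :: "complex mat \<Rightarrow> complex" where
  "mat_trace A = (\<Sum>i<dim_row A. A $$ (i, i))"

definition mat_exp :: "complex mat \<Rightarrow> complex mat" where
  "mat_exp A = Matrix.mat (dim_row A) (dim_col A) (\<lambda>ij. \<Sum>k. (A ^\<^sub>m k) $$ ij / fact k)"

definition ketbra :: "complex Matrix.vec \<Rightarrow> complex mat" where
  "ketbra v = Matrix.mat (dim_vec v) (dim_vec v) (\<lambda>(r, c). vec_index v r * cnj (vec_index v c))"

definition ket0 :: "complex Matrix.vec" where
  "ket0 = vec_of_list [1, 0]"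

definition bloch_ket :: "real \<Rightarrow> real \<Rightarrow> complex Matrix.vec" where
  "bloch_ket \<theta> \<phi> =
     vec_of_list [complex_of_real (cos (\<theta> / 2)), exp (\<i> * complex_of_real \<phi>) * complex_of_real (sin (\<theta> / 2))]"

definition pauli_x :: "complex mat" where
  "pauli_x = mat_of_rows_list 2 [[0, 1], [1, 0]]"

definition pauli_y :: "complex mat" where
  "pauli_y = mat_of_rows_list 2 [[0, - \<i>], [\<i>, 0]]"

definition pauli_z :: "complex mat" where
  "pauli_z = mat_of_rows_list 2 [[1, 0], [0, - 1]]"

definition pauli_dot :: "real^3 \<Rightarrow> complex mat" where
  "pauli_dot u = complex_of_real (u $ 1) \<cdot>\<^sub>m pauli_x + complex_of_real (u $ 2) \<cdot>\<^sub>m pauli_y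
     + complex_of_real (u $ 3) \<cdot>\<^sub>m pauli_z"

definition qubit_rotation :: "real^3 \<Rightarrow> real \<Rightarrow> complex mat" where
  "qubit_rotation u \<alpha> = mat_exp ((- \<i> * complex_of_real (\<alpha> / 2)) \<cdot>\<^sub>m pauli_dot u)"

text \<open>Rodrigues' formula for the right-handed rotation about the unit vector \<open>u\<close> by the angle \<open>\<alpha>\<close>.\<close>

definition rotate3 :: "real^3 \<Rightarrow> real \<Rightarrow> real^3 \<Rightarrow> real^3" where
  "rotate3 u \<alpha> v = cos \<alpha> *\<^sub>R v + sin \<alpha> *\<^sub>R cross3 u v + ((1 - cos \<alpha>) * (u \<bullet> v)) *\<^sub>R u"

definition cnot :: "nat \<Rightarrow> nat \<Rightarrow> nat \<Rightarrow> complex mat" where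
  "cnot n i j = Matrix.mat (2 ^ n) (2 ^ n)
     (\<lambda>(r, c). if r = (if bit c (n - i) then flip_bit (n - j) c else c) then 1 else 0)"

definition cnot_chain :: "nat \<Rightarrow> complex mat" where
  "cnot_chain n = foldr (\<lambda>j M. cnot n 1 j * M) [2..<Suc n] (1\<^sub>m (2 ^ n))"

definition sync_unitary :: "nat \<Rightarrow> real^3 \<Rightarrow> real \<Rightarrow> complex mat" where
  "sync_unitary n u \<alpha> = tensor_pow (qubit_rotation u \<alpha>) n * cnot_chain n"

definition set_qubit :: "nat \<Rightarrow> nat \<Rightarrow> nat \<Rightarrow> nat \<Rightarrow> nat" where
  "set_qubit n i a k = (if a = 1 then set_bit (n - i) k else unset_bit (n - i) k)"

text \<open>
  Partial trace over all qubits except qubit \<open>i\<close>: the indices \<open>k\<close> whose qubit \<open>i\<close> is in state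
  \<open>0\<close> enumerate the basis states of the remaining qubits.
\<close>

definition reduced_state :: "nat \<Rightarrow> nat \<Rightarrow> complex mat \<Rightarrow> complex mat" where
  "reduced_state n i \<rho> = Matrix.mat 2 2
     (\<lambda>(a, b). \<Sum>k | k < 2 ^ n \<and> \<not> bit k (n - i). \<rho> $$ (set_qubit n i a k, set_qubit n i b k))"

text \<open>For Hermitian \<open>\<rho>\<close> the traces are real, so that taking real parts loses nothing.\<close>

definition bloch_vector :: "complex mat \<Rightarrow> real^3" where
  "bloch_vector \<rho> = vector [Re (mat_trace (pauli_x * \<rho>)), Re (mat_trace (pauli_y * \<rho>)),
     Re (mat_trace (pauli_z * \<rho>))]"

definition bloch_xy :: "complex mat \<Rightarrow> real^2" where
  "bloch_xy \<rho> = vector [bloch_vector \<rho> $ 1, bloch_vector \<rho> $ 2]"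

definition phase_defined :: "complex mat \<Rightarrow> bool" where
  "phase_defined \<rho> \<longleftrightarrow> bloch_xy \<rho> \<noteq> 0"

text \<open>Meaningful only when both phases are defined (otherwise it takes the value \<open>0\<close>).\<close>

definition phase_fidelity :: "complex mat \<Rightarrow> complex mat \<Rightarrow> real" where
  "phase_fidelity \<rho>\<^sub>1 \<rho>\<^sub>2 =
     (bloch_xy \<rho>\<^sub>1 \<bullet> bloch_xy \<rho>\<^sub>2) / (norm (bloch_xy \<rho>\<^sub>1) * norm (bloch_xy \<rho>\<^sub>2))"

definition noisy_qubit :: "real \<Rightarrow> real \<Rightarrow> real \<Rightarrow> complex mat" where
  "noisy_qubit p \<theta> \<phi> = complex_of_real ((1 - p) / 2) \<cdot>\<^sub>m 1\<^sub>m 2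
     + complex_of_real p \<cdot>\<^sub>m ketbra (bloch_ket \<theta> \<phi>)"

definition initial_state :: "nat \<Rightarrow> real \<Rightarrow> real \<Rightarrow> real \<Rightarrow> complex mat" where
  "initial_state n p \<theta> \<phi> = tensor_mat (noisy_qubit p \<theta> \<phi>) (tensor_pow (ketbra ket0) (n - 1))"

end

theory Submission
  imports Defs
begin

text \<open>
  The CNOT chain sends the basis states \<open>|0\<dots>0\<rangle>\<close> and \<open>|10\<dots>0\<rangle>\<close> to \<open>|0\<dots>0\<rangle>\<close> and \<open>|1\<dots>1\<rangle>\<close>, so
  after the local rotation \<open>R\<close> the matrix entries of the state are sums over bits \<open>a\<close>, \<open>b\<close> of
  \<open>\<rho>\<^sub>1(a, b)\<close> times a product over the qubits. Tracing out at least one qubit kills the terms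
  \<open>a \<noteq> b\<close>, because the columns of \<open>R\<close> are orthonormal. Hence all qubits have the same
  reduced state, namely the diagonal part of \<open>\<rho>\<^sub>1\<close> conjugated by \<open>R\<close>, whose Bloch vector is
  \<open>p cos \<theta>\<^sub>1\<close> times the rotated unit vector along the \<open>z\<close>-axis.
\<close>

section \<open>Entries of tensor powers and sums over bit strings\<close>

lemma tensor_pow_carrier:
  assumes "A \<in> carrier_mat 2 2"
  shows "tensor_pow A n \<in> carrier_mat (2 ^ n) (2 ^ n)"
  using assms by (induction n) (auto simp: tensor_mat_def)

lemma nat_div_power_of_bool_bit:
  fixes r :: nat
  assumes "r < 2 ^ Suc n"
  shows "r div 2 ^ n = of_bool (bit r n)"
proof -
  have "r div 2 ^ n < 2"
    using assms by (simp add: less_mult_imp_div_less)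
  then show ?thesis
    by (auto simp: bit_iff_odd less_2_cases_iff)
qed

text \<open>The recursion peels off the leftmost factor, which belongs to the highest bit. The
  product runs over bit positions rather than qubit numbers; as all factors equal \<open>A\<close>,
  this reversal is harmless.\<close>

lemma tensor_pow_index:
  assumes "A \<in> carrier_mat 2 2" "r < 2 ^ n" "c < 2 ^ n"
  shows "tensor_pow A n $$ (r, c) = (\<Prod>j<n. A $$ (of_bool (bit r j), of_bool (bit c j)))"
  using assms(2,3)
proof (induction n arbitrary: r c)
  case 0
  then show ?case by simp
next
  case (Suc n)
  have dims: "dim_row A = 2" "dim_col A = 2"
      "dim_row (tensor_pow A n) = 2 ^ n" "dim_col (tensor_pow A n) = 2 ^ n"
    using assms(1) tensor_pow_carrier[OF assms(1), of n] by auto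
  have "tensor_pow A (Suc n) $$ (r, c) =
      A $$ (r div 2 ^ n, c div 2 ^ n) * tensor_pow A n $$ (r mod 2 ^ n, c mod 2 ^ n)"
    using Suc.prems by (simp add: tensor_mat_def dims)
  also have "tensor_pow A n $$ (r mod 2 ^ n, c mod 2 ^ n) =
      (\<Prod>j<n. A $$ (of_bool (bit (r mod 2 ^ n) j), of_bool (bit (c mod 2 ^ n) j)))"
    by (rule Suc.IH) auto
  also have "\<dots> = (\<Prod>j<n. A $$ (of_bool (bit r j), of_bool (bit c j)))"
    by (intro prod.cong) (auto simp: bit_take_bit_iff simp flip: take_bit_eq_mod)
  finally show ?case
    using Suc.prems by (simp add: nat_div_power_of_bool_bit mult.commute)
qed

text \<open>This is the distributive law: expanding the right-hand product chooses one bit for each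
  position. The induction splits the indices by their top bit.\<close>

lemma sum_bit_product:
  fixes h :: "nat \<Rightarrow> bool \<Rightarrow> 'a :: comm_semiring_1"
  shows "(\<Sum>k<2 ^ n :: nat. \<Prod>j<n. h j (bit k j)) = (\<Prod>j<n. h j False + h j True)"
proof (induction n)
  case 0
  then show ?case by simp
next
  case (Suc n)
  have split: "{..<2 ^ Suc n} = {..<2 ^ n} \<union> (\<lambda>k. k + 2 ^ n) ` {..<2 ^ n :: nat}"
  proof (intro equalityI subsetI)
    fix k :: nat assume "k \<in> {..<2 ^ Suc n}"
    then show "k \<in> {..<2 ^ n} \<union> (\<lambda>k. k + 2 ^ n) ` {..<2 ^ n}"
      by (cases "k < 2 ^ n") (auto intro!: image_eqI[of _ _ "k - 2 ^ n"])
  qed auto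
  have low: "\<not> bit k n" if "k < 2 ^ n" for k :: nat
    using that by (simp add: bit_iff_odd)
  have high: "bit (k + 2 ^ n) j \<longleftrightarrow> (if j = n then True else bit k j)"
    if "k < 2 ^ n" "j < Suc n" for k j :: nat
  proof (cases "j = n")
    case False
    have "take_bit n (k + 2 ^ n) = take_bit n k"
      by (simp add: take_bit_eq_mod)
    then show ?thesis
      using False that by (metis bit_take_bit_iff less_antisym)
  qed (use that in \<open>simp add: bit_iff_odd\<close>)
  have "(\<Sum>k<2 ^ Suc n :: nat. \<Prod>j<Suc n. h j (bit k j)) =
      (\<Sum>k<2 ^ n :: nat. \<Prod>j<Suc n. h j (bit k j)) +
      (\<Sum>k<2 ^ n :: nat. \<Prod>j<Suc n. h j (bit (k + 2 ^ n) j))"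
    unfolding split by (subst sum.union_disjoint) (auto simp: sum.reindex)
  also have "(\<Sum>k<2 ^ n :: nat. \<Prod>j<Suc n. h j (bit k j)) =
      (\<Sum>k<2 ^ n :: nat. \<Prod>j<n. h j (bit k j)) * h n False"
    by (simp add: sum_distrib_right low)
  also have "(\<Sum>k<2 ^ n :: nat. \<Prod>j<Suc n. h j (bit (k + 2 ^ n) j)) =
      (\<Sum>k<2 ^ n :: nat. \<Prod>j<n. h j (bit k j)) * h n True"
    unfolding sum_distrib_right
    by (intro sum.cong) (auto simp: high intro!: arg_cong2[of _ _ _ _ "(*)"] prod.cong)
  finally show ?case
    by (simp add: Suc.IH algebra_simps)
qed

text \<open>Evaluates the sum in a partial trace. The restriction on bit \<open>m\<close> becomes a
  factor at position \<open>m\<close> that is 1 for a cleared bit and 0 for a set one, so the sum is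
  unrestricted and that position contributes 0 + 1.\<close>

lemma sum_bit_product_except:
  fixes h :: "bool \<Rightarrow> 'a :: comm_semiring_1"
  assumes "m < n"
  shows "(\<Sum>k :: nat | k < 2 ^ n \<and> \<not> bit k m. \<Prod>j\<in>{..<n} - {m}. h (bit k j)) =
    (h False + h True) ^ (n - 1)"
proof -
  let ?h = "\<lambda>j b. if j = m then of_bool (\<not> b) else h b"
  have *: "(\<Prod>j<n. g j) = g m * (\<Prod>j\<in>{..<n} - {m}. g j)" for g :: "nat \<Rightarrow> 'a"
    using assms by (intro prod.remove) auto
  have "(\<Sum>k :: nat | k < 2 ^ n \<and> \<not> bit k m. \<Prod>j\<in>{..<n} - {m}. h (bit k j)) =
      (\<Sum>k<2 ^ n :: nat. \<Prod>j<n. ?h j (bit k j))"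
    unfolding *
    by (intro sum.mono_neutral_cong_left) auto
  also have "\<dots> = (\<Prod>j<n. ?h j False + ?h j True)"
    by (rule sum_bit_product)
  also have "\<dots> = (h False + h True) ^ (n - 1)"
    unfolding * using assms by simp
  finally show ?thesis .
qed

section \<open>The CNOT chain as a map on basis indices\<close>

definition chain_map :: "nat \<Rightarrow> nat list \<Rightarrow> nat \<Rightarrow> nat" where
  "chain_map n js c = foldr (\<lambda>j k. if bit k (n - 1) then flip_bit (n - j) k else k) js c"

lemma flip_bit_less_power:
  fixes k :: nat
  assumes "k < 2 ^ n" "m < n"
  shows "flip_bit m k < 2 ^ n"
proof -
  have "take_bit n (flip_bit m k) = flip_bit m k"
    using assms by (simp add: take_bit_flip_bit_eq take_bit_nat_eq_self)
  then show ?thesis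
    by (metis take_bit_nat_less_exp)
qed

lemma chain_map_less:
  assumes "c < 2 ^ n" "set js \<subseteq> {2..n}"
  shows "chain_map n js c < 2 ^ n"
  using assms by (induction js) (auto simp: chain_map_def flip_bit_less_power)

text \<open>A CNOT sends each basis state to a single basis state, so multiplying such matrices
  composes their index maps. In both folds the last list element acts first.\<close>

lemma cnot_foldr_index:
  assumes "set js \<subseteq> {2..n}"
  shows "foldr (\<lambda>j M. cnot n 1 j * M) js (1\<^sub>m (2 ^ n)) =
    Matrix.mat (2 ^ n) (2 ^ n) (\<lambda>(r, c). of_bool (r = chain_map n js c))"
  using assms
proof (induction js)
  case Nil
  then show ?case by (auto simp: chain_map_def)
next
  case (Cons j js)
  show ?case
  proof (rule eq_matI)
    fix r c assume rc: "r < dim_row (Matrix.mat (2 ^ n) (2 ^ n)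
        (\<lambda>(r, c). of_bool (r = chain_map n (j # js) c) :: complex))"
      "c < dim_col (Matrix.mat (2 ^ n) (2 ^ n)
        (\<lambda>(r, c). of_bool (r = chain_map n (j # js) c) :: complex))"
    have less: "chain_map n js c < 2 ^ n"
      using Cons.prems rc by (intro chain_map_less) auto
    let ?f = "\<lambda>k. if bit k (n - 1) then flip_bit (n - j) k else k"
    have "(cnot n 1 j * Matrix.mat (2 ^ n) (2 ^ n) (\<lambda>(r, c). of_bool (r = chain_map n js c))) $$ (r, c)
      = (\<Sum>k\<in>{0..<2 ^ n}. (if r = ?f k then 1 else 0) * of_bool (k = chain_map n js c))"
      using rc by (simp add: cnot_def scalar_prod_def)
    also have "\<dots> = (\<Sum>k\<in>{0..<2 ^ n}. if k = chain_map n js c then of_bool (r = ?f k) else 0)"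
      by (intro sum.cong) auto
    also have "\<dots> = of_bool (r = ?f (chain_map n js c))"
      using less by simp
    also have "?f (chain_map n js c) = chain_map n (j # js) c"
      by (simp add: chain_map_def)
    finally show "foldr (\<lambda>j M. cnot n 1 j * M) (j # js) (1\<^sub>m (2 ^ n)) $$ (r, c) =
        Matrix.mat (2 ^ n) (2 ^ n) (\<lambda>(r, c). of_bool (r = chain_map n (j # js) c)) $$ (r, c)"
      using Cons rc by simp
  qed (use Cons in \<open>auto simp: cnot_def\<close>)
qed

lemma chain_map_zero: "chain_map n js 0 = 0"
  by (induction js) (auto simp: chain_map_def)

text \<open>The control is bit \<open>n - 1\<close>, which no target with \<open>j\<close> at least
  2 touches, so it stays set and every flip takes place. Distinct targets occupy distinct positions,
  so no flip is undone.\<close>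

lemma bit_chain_map:
  assumes "distinct js" "set js \<subseteq> {2..n}"
  shows "bit (chain_map n js (2 ^ (n - 1))) i \<longleftrightarrow> i = n - 1 \<or> (\<exists>j\<in>set js. i = n - j)"
  using assms
proof (induction js arbitrary: i)
  case Nil
  then show ?case by (auto simp: chain_map_def bit_exp_iff)
next
  case (Cons j js)
  have IH: "bit (chain_map n js (2 ^ (n - 1))) i \<longleftrightarrow> i = n - 1 \<or> (\<exists>j\<in>set js. i = n - j)" for i
    using Cons by simp
  \<comment> \<open>The induction hypothesis at \<open>n - 1\<close> says that the control is still
    set.\<close>
  have "chain_map n (j # js) (2 ^ (n - 1)) = flip_bit (n - j) (chain_map n js (2 ^ (n - 1)))"
    using IH[of "n - 1"] by (simp add: chain_map_def)
  moreover have "n - j \<noteq> n - j'" if "j' \<in> set js" for j'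
  proof -
    have "j \<noteq> j'" "j \<le> n" "j' \<le> n"
      using Cons.prems that by auto
    then show ?thesis by simp
  qed
  moreover have "n - j \<noteq> n - 1"
    using Cons.prems by auto
  ultimately show ?case
    using IH by (auto simp: bit_flip_bit_iff)
qed

lemma cnot_chain_eq:
  "cnot_chain n = Matrix.mat (2 ^ n) (2 ^ n) (\<lambda>(r, c). of_bool (r = chain_map n [2..<Suc n] c))"
  unfolding cnot_chain_def by (rule cnot_foldr_index) auto

lemma cnot_chain_carrier: "cnot_chain n \<in> carrier_mat (2 ^ n) (2 ^ n)"
  by (simp add: cnot_chain_eq)

lemma bit_chain_map_full:
  assumes "i < n"
  shows "bit (chain_map n [2..<Suc n] (2 ^ (n - 1))) i"
proof (cases "i = n - 1")
  case False
  \<comment> \<open>Bit position \<open>i\<close> belongs to qubit \<open>n - i\<close>, which is a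
    target because it is not qubit 1.\<close>
  then have "i = n - (n - i)" "n - i \<in> set [2..<Suc n]"
    using assms by auto
  then show ?thesis
    by (subst bit_chain_map) (simp, force simp del: upt_Suc, blast)
qed (subst bit_chain_map; auto)

text \<open>Only the columns of the states \<open>|0...0>\<close> and \<open>|10...0>\<close> meet
  the support of the initial state. The chain turns them into strings of equal bits, so every tensor
  factor is read in the same column \<open>a\<close>.\<close>

lemma sync_column:
  assumes "A \<in> carrier_mat 2 2" "n \<ge> 1" "r < 2 ^ n"
  shows "(tensor_pow A n * cnot_chain n) $$ (r, of_bool a * 2 ^ (n - 1)) =
    (\<Prod>j<n. A $$ (of_bool (bit r j), of_bool a))"
proof -
  let ?c = "of_bool a * 2 ^ (n - 1) :: nat"
  let ?d = "chain_map n [2..<Suc n] ?c"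
  have c: "?c < 2 ^ n"
    using assms by simp
  have d: "?d < 2 ^ n"
    by (rule chain_map_less[OF c]) auto
  have dims: "dim_row (tensor_pow A n) = 2 ^ n" "dim_col (tensor_pow A n) = 2 ^ n"
     "dim_row (cnot_chain n) = 2 ^ n" "dim_col (cnot_chain n) = 2 ^ n"
    using tensor_pow_carrier[OF assms(1), of n] cnot_chain_carrier[of n] by auto
  have "(tensor_pow A n * cnot_chain n) $$ (r, ?c) =
      (\<Sum>k\<in>{0..<2 ^ n}. tensor_pow A n $$ (r, k) * cnot_chain n $$ (k, ?c))"
    using assms c by (simp add: scalar_prod_def dims)
  also have "\<dots> = (\<Sum>k\<in>{0..<2 ^ n}. if k = ?d then tensor_pow A n $$ (r, k) else 0)"
    using assms c by (intro sum.cong) (auto simp: cnot_chain_eq simp del: upt_Suc)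
  also have "\<dots> = tensor_pow A n $$ (r, ?d)"
    using d by simp
  also have "\<dots> = (\<Prod>j<n. A $$ (of_bool (bit r j), of_bool (bit ?d j)))"
    by (rule tensor_pow_index[OF assms(1,3) d])
  also have "\<dots> = (\<Prod>j<n. A $$ (of_bool (bit r j), of_bool a))"
    using bit_chain_map_full[of _ n]
    by (intro prod.cong) (cases a; auto simp: chain_map_zero)+
  finally show ?thesis .
qed

section \<open>The initial state and its conjugation by the circuit\<close>

lemma ketbra_ket0_carrier: "ketbra ket0 \<in> carrier_mat 2 2"
  by (auto simp: ketbra_def ket0_def)

lemma tensor_pow_ket0_index:
  assumes "r < 2 ^ n" "c < 2 ^ n"
  shows "tensor_pow (ketbra ket0) n $$ (r, c) = of_bool (r = 0 \<and> c = 0)"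
  using assms
proof (induction n arbitrary: r c)
  case 0
  then show ?case by simp
next
  case (Suc n)
  have A: "ketbra ket0 \<in> carrier_mat 2 2"
    by (rule ketbra_ket0_carrier)
  have dims: "dim_row (ketbra ket0) = 2" "dim_col (ketbra ket0) = 2"
      "dim_row (tensor_pow (ketbra ket0) n) = 2 ^ n" "dim_col (tensor_pow (ketbra ket0) n) = 2 ^ n"
    using A tensor_pow_carrier[OF A, of n] by auto
  have lt: "r div 2 ^ n < 2" "c div 2 ^ n < 2"
    using Suc.prems by (simp_all add: less_mult_imp_div_less)
  have "tensor_pow (ketbra ket0) (Suc n) $$ (r, c) =
      ketbra ket0 $$ (r div 2 ^ n, c div 2 ^ n) * of_bool (r mod 2 ^ n = 0 \<and> c mod 2 ^ n = 0)"
    using Suc.prems by (simp add: tensor_mat_def dims Suc.IH)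
  also have "ketbra ket0 $$ (r div 2 ^ n, c div 2 ^ n) = of_bool (r div 2 ^ n = 0 \<and> c div 2 ^ n = 0)"
    using lt by (auto simp: ketbra_def ket0_def less_2_cases_iff)
  finally show ?case
    by (auto simp: mod_div_trivial) (metis div_mult_mod_eq mult_0 add_0 mod_div_trivial)+
qed


lemma mat_adjoint_index:
  assumes "r < dim_col A" "c < dim_row A"
  shows "mat_adjoint A $$ (r, c) = cnj (A $$ (c, r))"
  using assms by (simp add: mat_adjoint_def mat_of_rows_def)

lemma mat_adjoint_carrier: "A \<in> carrier_mat m k \<Longrightarrow> mat_adjoint A \<in> carrier_mat k m"
  by (simp add: mat_adjoint_def mat_of_rows_def)

lemma conjugate_index:
  assumes A: "A \<in> carrier_mat N N" and B: "B \<in> carrier_mat N N" and "r < N" "s < N"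
  shows "(A * B * mat_adjoint A) $$ (r, s) =
    (\<Sum>l<N. \<Sum>k<N. A $$ (r, k) * B $$ (k, l) * cnj (A $$ (s, l)))"
proof -
  have dims: "dim_row A = N" "dim_col A = N" "dim_row B = N" "dim_col B = N"
    "dim_row (mat_adjoint A) = N" "dim_col (mat_adjoint A) = N"
    using A B mat_adjoint_carrier[OF A] by auto
  then show ?thesis
    using assms(3,4)
    by (simp add: scalar_prod_def mat_adjoint_index sum_distrib_right lessThan_atLeast0)
qed

lemma noisy_qubit_carrier: "noisy_qubit p \<theta> \<phi> \<in> carrier_mat 2 2"
  by (auto simp: noisy_qubit_def ketbra_def bloch_ket_def)

lemma initial_state_carrier:
  assumes "n \<ge> 1"
  shows "initial_state n p \<theta> \<phi> \<in> carrier_mat (2 ^ n) (2 ^ n)"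
  using assms noisy_qubit_carrier[of p \<theta> \<phi>] tensor_pow_carrier[OF ketbra_ket0_carrier, of "n - 1"]
  by (cases n) (auto simp: initial_state_def tensor_mat_def)

lemma initial_state_index:
  assumes "n \<ge> 1" "r < 2 ^ n" "c < 2 ^ n"
  shows "initial_state n p \<theta> \<phi> $$ (r, c) =
    (if r mod 2 ^ (n - 1) = 0 \<and> c mod 2 ^ (n - 1) = 0
     then noisy_qubit p \<theta> \<phi> $$ (r div 2 ^ (n - 1), c div 2 ^ (n - 1)) else 0)"
  using assms noisy_qubit_carrier[of p \<theta> \<phi>] tensor_pow_carrier[OF ketbra_ket0_carrier, of "n - 1"]
  by (cases n) (auto simp: initial_state_def tensor_mat_def tensor_pow_ket0_index)

text \<open>Below \<open>2 ^ n\<close>, only 0 and \<open>2 ^ (n - 1)\<close> have all lower bits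
  zero. This reduces a sum against the initial state to the two values of qubit 1.\<close>

lemma sum_top_bit:
  fixes F :: "nat \<Rightarrow> 'a :: comm_monoid_add"
  assumes "n \<ge> 1" "\<And>k. k < 2 ^ n \<Longrightarrow> k mod 2 ^ (n - 1) \<noteq> 0 \<Longrightarrow> F k = 0"
  shows "(\<Sum>k<2 ^ n. F k) = (\<Sum>a\<in>UNIV. F (of_bool a * 2 ^ (n - 1)))"
proof -
  obtain m where n: "n = Suc m"
    using assms(1) by (cases n) auto
  have "(\<Sum>k<2 ^ n. F k) = (\<Sum>k\<in>(\<lambda>a. of_bool a * 2 ^ (n - 1)) ` UNIV. F k)"
  proof (rule sum.mono_neutral_right)
    show "\<forall>k\<in>{..<2 ^ n} - (\<lambda>a. of_bool a * 2 ^ (n - 1)) ` UNIV. F k = 0"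
    proof
      fix k :: nat assume k: "k \<in> {..<2 ^ n} - (\<lambda>a. of_bool a * 2 ^ (n - 1)) ` UNIV"
      then have "k div 2 ^ m = of_bool (bit k m)"
        by (intro nat_div_power_of_bool_bit) (simp add: n)
      then have "k mod 2 ^ m = 0 \<Longrightarrow> k = of_bool (bit k m) * 2 ^ m"
        by (metis add.right_neutral div_mult_mod_eq)
      with k have "k mod 2 ^ m \<noteq> 0"
        by (auto simp: n)
      with k assms(2) n show "F k = 0" by simp
    qed
  qed (auto simp: n)
  also have "\<dots> = (\<Sum>a\<in>UNIV. F (of_bool a * 2 ^ (n - 1)))"
    by (subst sum.reindex) (auto simp: inj_on_def)
  finally show ?thesis .
qed

lemma sync_state_index:
  assumes R: "R \<in> carrier_mat 2 2" and n: "n \<ge> 1" and rs: "r < 2 ^ n" "s < 2 ^ n"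
    and U: "U = tensor_pow R n * cnot_chain n"
  shows "(U * initial_state n p \<theta> \<phi> * mat_adjoint U) $$ (r, s) =
    (\<Sum>b\<in>UNIV. \<Sum>a\<in>UNIV. noisy_qubit p \<theta> \<phi> $$ (of_bool a, of_bool b) *
      (\<Prod>j<n. R $$ (of_bool (bit r j), of_bool a) * cnj (R $$ (of_bool (bit s j), of_bool b))))"
proof -
  let ?M = "2 ^ (n - 1) :: nat"
  let ?\<rho> = "initial_state n p \<theta> \<phi>"
  have lt: "of_bool a * ?M < 2 ^ n" for a
    using n by simp
  have "(U * ?\<rho> * mat_adjoint U) $$ (r, s) =
      (\<Sum>l<2 ^ n. \<Sum>k<2 ^ n. U $$ (r, k) * ?\<rho> $$ (k, l) * cnj (U $$ (s, l)))"
    using tensor_pow_carrier[OF R, of n] cnot_chain_carrier[of n] rs n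
    by (intro conjugate_index initial_state_carrier) (auto simp: U)
  \<comment> \<open>The initial state vanishes unless both its indices have zero lower bits, so the
    inner sum collapses here and the outer one next.\<close>
  also have "\<dots> = (\<Sum>l<2 ^ n. \<Sum>a\<in>UNIV. U $$ (r, of_bool a * ?M) * ?\<rho> $$ (of_bool a * ?M, l) * cnj (U $$ (s, l)))"
    using n by (intro sum.cong refl sum_top_bit) (auto simp: initial_state_index)
  also have "\<dots> = (\<Sum>b\<in>UNIV. \<Sum>a\<in>UNIV. U $$ (r, of_bool a * ?M) *
      ?\<rho> $$ (of_bool a * ?M, of_bool b * ?M) * cnj (U $$ (s, of_bool b * ?M)))"
    using n by (intro sum_top_bit) (auto simp: initial_state_index lt)
  also have "\<dots> = (\<Sum>b\<in>UNIV. \<Sum>a\<in>UNIV. noisy_qubit p \<theta> \<phi> $$ (of_bool a, of_bool b) *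
      (\<Prod>j<n. R $$ (of_bool (bit r j), of_bool a) * cnj (R $$ (of_bool (bit s j), of_bool b))))"
    using n by (intro sum.cong refl)
      (simp only: initial_state_index lt U sync_column[OF R n] rs prod.distrib cnj_prod, simp)
  finally show ?thesis .
qed

section \<open>The partial trace over all but one qubit\<close>

lemma bit_set_qubit:
  "bit (set_qubit n i x k) j \<longleftrightarrow> (if j = n - i then x = 1 else bit k j)"
  by (auto simp: set_qubit_def bit_set_bit_iff bit_unset_bit_iff)

lemma set_qubit_less:
  assumes "k < 2 ^ n" "1 \<le> i" "i \<le> n"
  shows "set_qubit n i x k < 2 ^ n"
proof -
  have "n - i < n"
    using assms by linarith
  then have "take_bit n (set_qubit n i x k) = set_qubit n i x k"
    using assms(1) by (simp add: set_qubit_def take_bit_set_bit_eq take_bit_unset_bit_eq take_bit_nat_eq_self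
        del: One_nat_def)
  then show ?thesis
    by (metis take_bit_nat_less_exp)
qed

text \<open>Tracing out the other \<open>n - 1\<close> qubits multiplies the coherence between the columns \<open>a\<close> and
  \<open>b\<close> of \<open>R\<close> by the \<open>(n - 1)\<close>-th power of their inner product.\<close>

lemma reduced_sync_state_index:
  assumes R: "R \<in> carrier_mat 2 2" and n: "n \<ge> 2" and i: "1 \<le> i" "i \<le> n" and xy: "x < 2" "y < 2"
    and ortho: "\<And>a b. R $$ (0, of_bool a) * cnj (R $$ (0, of_bool b)) +
        R $$ (1, of_bool a) * cnj (R $$ (1, of_bool b)) = of_bool (a = b)"
    and U: "U = tensor_pow R n * cnot_chain n"
  shows "reduced_state n i (U * initial_state n p \<theta> \<phi> * mat_adjoint U) $$ (x, y) =
    (\<Sum>a\<in>UNIV. noisy_qubit p \<theta> \<phi> $$ (of_bool a, of_bool a) *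
      (R $$ (x, of_bool a) * cnj (R $$ (y, of_bool a))))"
proof -
  let ?S = "{k :: nat. k < 2 ^ n \<and> \<not> bit k (n - i)}"
  let ?d = "\<lambda>a b. noisy_qubit p \<theta> \<phi> $$ (of_bool a, of_bool b)"
  let ?g = "\<lambda>a b x y. R $$ (x, of_bool a) * cnj (R $$ (y, of_bool b))"
  \<comment> \<open>The kept qubit \<open>i\<close> sits at bit position \<open>n - i\<close>; the
    other positions carry the same bit in row and column and are summed over.\<close>
  have split: "(\<Prod>j<n. h j) = h (n - i) * (\<Prod>j\<in>{..<n} - {n - i}. h j)" for h :: "nat \<Rightarrow> complex"
    using i by (intro prod.remove) auto
  have xy': "of_bool (x = Suc 0) = x" "of_bool (y = Suc 0) = y"
    using xy by auto
  have prod: "(\<Prod>j<n. ?g a b (of_bool (bit (set_qubit n i x k) j)) (of_bool (bit (set_qubit n i y k) j))) =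
     ?g a b x y * (\<Prod>j\<in>{..<n} - {n - i}. ?g a b (of_bool (bit k j)) (of_bool (bit k j)))" for a b k
    unfolding split
    by (intro arg_cong2[of _ _ _ _ "(*)"] prod.cong) (simp_all add: bit_set_qubit xy' del: of_bool_eq_iff)
  have trace: "(\<Sum>k\<in>?S. \<Prod>j\<in>{..<n} - {n - i}. ?g a b (of_bool (bit k j)) (of_bool (bit k j))) =
      of_bool (a = b)" for a b
  proof -
    have "(\<Sum>k\<in>?S. \<Prod>j\<in>{..<n} - {n - i}. ?g a b (of_bool (bit k j)) (of_bool (bit k j))) =
        (?g a b (of_bool False) (of_bool False) + ?g a b (of_bool True) (of_bool True)) ^ (n - 1)"
      using i by (intro sum_bit_product_except) auto
    \<comment> \<open>For \<open>a \<noteq> b\<close> the base is 0 and the exponent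
      \<open>n - 1\<close> is positive because \<open>n \<ge> 2\<close>; with a single qubit the
      power would be 1 and the coherences would survive.\<close>
    then show ?thesis
      using n ortho[of a b] by (simp add: power_0_left)
  qed
  have "reduced_state n i (U * initial_state n p \<theta> \<phi> * mat_adjoint U) $$ (x, y) =
      (\<Sum>k\<in>?S. (U * initial_state n p \<theta> \<phi> * mat_adjoint U) $$ (set_qubit n i x k, set_qubit n i y k))"
    using xy by (simp add: reduced_state_def)
  also have "\<dots> = (\<Sum>k\<in>?S. \<Sum>b\<in>UNIV. \<Sum>a\<in>UNIV. ?d a b * (?g a b x y *
      (\<Prod>j\<in>{..<n} - {n - i}. ?g a b (of_bool (bit k j)) (of_bool (bit k j)))))"
  proof (intro sum.cong refl)
    fix k assume "k \<in> ?S"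
    then have "set_qubit n i x k < 2 ^ n" "set_qubit n i y k < 2 ^ n"
      using i by (auto intro: set_qubit_less)
    with n show "(U * initial_state n p \<theta> \<phi> * mat_adjoint U) $$ (set_qubit n i x k, set_qubit n i y k) =
        (\<Sum>b\<in>UNIV. \<Sum>a\<in>UNIV. ?d a b * (?g a b x y *
          (\<Prod>j\<in>{..<n} - {n - i}. ?g a b (of_bool (bit k j)) (of_bool (bit k j)))))"
      by (subst sync_state_index[OF R _ _ _ U]) (linarith | assumption | simp only: prod)+
  qed
  also have "\<dots> = (\<Sum>b\<in>UNIV. \<Sum>a\<in>UNIV. ?d a b * (?g a b x y *
      (\<Sum>k\<in>?S. \<Prod>j\<in>{..<n} - {n - i}. ?g a b (of_bool (bit k j)) (of_bool (bit k j)))))"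
    by (simp only: sum_distrib_left sum.swap[of _ "UNIV :: bool set" ?S])
  also have "\<dots> = (\<Sum>b\<in>UNIV. \<Sum>a\<in>UNIV. ?d a b * (?g a b x y * of_bool (a = b)))"
    by (simp only: trace)
  also have "\<dots> = (\<Sum>a\<in>UNIV. ?d a a * ?g a a x y)"
    by (simp add: UNIV_bool)
  finally show ?thesis .
qed

section \<open>Pauli matrices and the closed form of a qubit rotation\<close>

lemma norm_1_components:
  fixes u :: "real^3"
  assumes "norm u = 1"
  shows "(u $ 1)\<^sup>2 + (u $ 2)\<^sup>2 + (u $ 3)\<^sup>2 = 1"
  using assms by (simp add: norm_eq_1 inner_vec_def sum_3 power2_eq_square)

lemma less_2_iff: "(i :: nat) < 2 \<longleftrightarrow> i = 0 \<or> i = 1"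
  by auto

lemma pauli_dot_eq:
  "pauli_dot u = mat_of_rows_list 2
    [[of_real (u $ 3), of_real (u $ 1) - \<i> * of_real (u $ 2)],
     [of_real (u $ 1) + \<i> * of_real (u $ 2), - of_real (u $ 3)]]"
  by (rule eq_matI)
    (auto simp: pauli_dot_def pauli_x_def pauli_y_def pauli_z_def mat_of_rows_list_def less_2_iff less_Suc_eq)

lemma pauli_dot_carrier: "pauli_dot u \<in> carrier_mat 2 2"
  by (auto simp: pauli_dot_eq mat_of_rows_list_def)

lemma pauli_dot_square:
  assumes "norm u = 1"
  shows "pauli_dot u * pauli_dot u = 1\<^sub>m 2"
proof -
  have *: "complex_of_real (u $ 1) ^ 2 + of_real (u $ 2) ^ 2 + of_real (u $ 3) ^ 2 = 1"
    using arg_cong[OF norm_1_components[OF assms], of complex_of_real] by simp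
  show ?thesis
    using *
    by (intro eq_matI)
      (auto simp: pauli_dot_eq mat_of_rows_list_def less_2_iff less_Suc_eq scalar_prod_def numeral_2_eq_2
        power2_eq_square algebra_simps)
qed

lemma involution_smult_power:
  fixes P :: "complex mat"
  assumes P: "P \<in> carrier_mat m m" and sq: "P * P = 1\<^sub>m m"
  shows "(z \<cdot>\<^sub>m P) ^\<^sub>m k = z ^ k \<cdot>\<^sub>m (if even k then 1\<^sub>m m else P)"
proof (induction k)
  case 0
  then show ?case using P by (auto intro!: eq_matI)
next
  case (Suc k)
  have "(z \<cdot>\<^sub>m P) ^\<^sub>m Suc k = (z ^ k \<cdot>\<^sub>m (if even k then 1\<^sub>m m else P)) * (z \<cdot>\<^sub>m P)"
    by (simp add: Suc.IH)
  also have "\<dots> = z ^ Suc k \<cdot>\<^sub>m ((if even k then 1\<^sub>m m else P) * P)"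
    using P by (auto simp: mult_smult_distrib[of _ m m] mult_smult_assoc_mat[of _ m m] intro!: eq_matI)
  finally show ?case
    using P sq by auto
qed

text \<open>The complementary idempotents \<open>(1 + P) / 2\<close> and \<open>(1 - P) / 2\<close>
  split the k-th power of \<open>z P\<close> into parts with coefficients \<open>z ^ k\<close> and
  \<open>(- z) ^ k\<close>. The matrix series thus becomes two scalar exponential series, and
  Euler's formula gives the cosine and sine.\<close>

lemma mat_exp_involution:
  fixes P :: "complex mat"
  assumes P: "P \<in> carrier_mat m m" and sq: "P * P = 1\<^sub>m m" and ij: "i < m" "j < m"
  shows "mat_exp ((- \<i> * of_real x) \<cdot>\<^sub>m P) $$ (i, j) =
    of_real (cos x) * of_bool (i = j) - \<i> * of_real (sin x) * P $$ (i, j)"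
proof -
  let ?z = "- \<i> * complex_of_real x"
  let ?d = "of_bool (i = j) :: complex"
  have series: "((?z \<cdot>\<^sub>m P) ^\<^sub>m k) $$ (i, j) / fact k =
     (?z ^ k /\<^sub>R fact k) * ((?d + P $$ (i, j)) / 2) +
     ((- ?z) ^ k /\<^sub>R fact k) * ((?d - P $$ (i, j)) / 2)" for k
    using P ij unfolding involution_smult_power[OF P sq]
    by (cases "even k") (auto simp: scaleR_conv_of_real field_simps)
  have "(\<lambda>k. ((?z \<cdot>\<^sub>m P) ^\<^sub>m k) $$ (i, j) / fact k) sums
     (exp ?z * ((?d + P $$ (i, j)) / 2) + exp (- ?z) * ((?d - P $$ (i, j)) / 2))"
    unfolding series by (intro sums_add sums_mult2 exp_converges)
  moreover have "exp ?z = of_real (cos x) - \<i> * of_real (sin x)"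
    "exp (- ?z) = of_real (cos x) + \<i> * of_real (sin x)"
    using cis_conv_exp[of x] cis_conv_exp[of "- x"] by (auto simp: complex_eq_iff)
  moreover have "(c - s) * ((d + q) / 2) + (c + s) * ((d - q) / 2) = c * d - s * q" for c s d q :: complex
    by (simp add: field_simps)
  ultimately have "(\<lambda>k. ((?z \<cdot>\<^sub>m P) ^\<^sub>m k) $$ (i, j) / fact k) sums
     (of_real (cos x) * ?d - \<i> * of_real (sin x) * P $$ (i, j))"
    by metis
  then show ?thesis
    using P ij by (simp add: mat_exp_def sums_iff)
qed

lemma qubit_rotation_carrier: "qubit_rotation u \<alpha> \<in> carrier_mat 2 2"
  using pauli_dot_carrier[of u] by (auto simp: qubit_rotation_def mat_exp_def)

lemma qubit_rotation_index:
  assumes "norm u = 1"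
  shows "qubit_rotation u \<alpha> $$ (0, 0) = Complex (cos (\<alpha> / 2)) (- sin (\<alpha> / 2) * u $ 3)"
    and "qubit_rotation u \<alpha> $$ (0, Suc 0) = Complex (- sin (\<alpha> / 2) * u $ 2) (- sin (\<alpha> / 2) * u $ 1)"
    and "qubit_rotation u \<alpha> $$ (Suc 0, 0) = Complex (sin (\<alpha> / 2) * u $ 2) (- sin (\<alpha> / 2) * u $ 1)"
    and "qubit_rotation u \<alpha> $$ (Suc 0, Suc 0) = Complex (cos (\<alpha> / 2)) (sin (\<alpha> / 2) * u $ 3)"
  unfolding qubit_rotation_def
  by (subst mat_exp_involution[OF pauli_dot_carrier pauli_dot_square[OF assms]];
      simp add: pauli_dot_eq mat_of_rows_list_def complex_eq_iff)+

section \<open>Rotated Bloch vectors and the common reduced state\<close>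

lemma rotate3_e3:
  "rotate3 u \<alpha> (axis 3 1) $ 1 = 2 * sin (\<alpha> / 2) * (cos (\<alpha> / 2) * u $ 2 + sin (\<alpha> / 2) * u $ 1 * u $ 3)"
  "rotate3 u \<alpha> (axis 3 1) $ 2 = 2 * sin (\<alpha> / 2) * (sin (\<alpha> / 2) * u $ 2 * u $ 3 - cos (\<alpha> / 2) * u $ 1)"
proof -
  \<comment> \<open>Half angles bring Rodrigues' formula into the terms of the entries of
    \<open>qubit_rotation\<close>, so that Bloch vectors can be compared as polynomials.\<close>
  have *: "sin \<alpha> = 2 * sin (\<alpha> / 2) * cos (\<alpha> / 2)" "cos \<alpha> = 1 - 2 * (sin (\<alpha> / 2))\<^sup>2"
    using sin_double[of "\<alpha> / 2"] cos_double_sin[of "\<alpha> / 2"] by auto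
  show "rotate3 u \<alpha> (axis 3 1) $ 1 = 2 * sin (\<alpha> / 2) * (cos (\<alpha> / 2) * u $ 2 + sin (\<alpha> / 2) * u $ 1 * u $ 3)"
    "rotate3 u \<alpha> (axis 3 1) $ 2 = 2 * sin (\<alpha> / 2) * (sin (\<alpha> / 2) * u $ 2 * u $ 3 - cos (\<alpha> / 2) * u $ 1)"
    unfolding rotate3_def *
    by (simp_all add: cross3_simps axis_def inner_axis[unfolded axis_def] power2_eq_square algebra_simps)
qed

lemma rotate3_e3_off_axis:
  assumes "rotate3 u \<alpha> (axis 3 1) \<notin> span {axis 3 1}"
  shows "rotate3 u \<alpha> (axis 3 1) $ 1 \<noteq> 0 \<or> rotate3 u \<alpha> (axis 3 1) $ 2 \<noteq> 0"
proof (rule ccontr)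
  let ?v = "rotate3 u \<alpha> (axis 3 1)"
  assume "\<not> ?thesis"
  then have "?v = (?v $ 3) *\<^sub>R axis 3 1"
    unfolding Finite_Cartesian_Product.vec_eq_iff forall_3 by (simp add: axis_def)
  then have "?v \<in> span {axis 3 1}"
    by (metis insertI1 span_base span_scale)
  with assms show False ..
qed

text \<open>The populations are free of \<open>\<phi>\<close> because the phase factor has modulus
  1; they are all that the partial trace keeps of the input qubit.\<close>

lemma noisy_qubit_diagonal:
  "noisy_qubit p \<theta> \<phi> $$ (0, 0) = of_real ((1 + p * cos \<theta>) / 2)"
  "noisy_qubit p \<theta> \<phi> $$ (Suc 0, Suc 0) = of_real ((1 - p * cos \<theta>) / 2)"
proof -
  have c: "complex_of_real (cos (\<theta> / 2)) * of_real (cos (\<theta> / 2)) = of_real ((1 + cos \<theta>) / 2)"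
    using cos_double_cos[of "\<theta> / 2"] unfolding of_real_mult[symmetric] by (simp add: power2_eq_square)
  have s: "complex_of_real (sin (\<theta> / 2)) * of_real (sin (\<theta> / 2)) = of_real ((1 - cos \<theta>) / 2)"
    using cos_double_sin[of "\<theta> / 2"] unfolding of_real_mult[symmetric] by (simp add: power2_eq_square)
  have phase: "exp (\<i> * of_real \<phi>) * cnj (exp (\<i> * of_real \<phi>)) = 1"
    by (simp add: complex_norm_square[symmetric])
  have "noisy_qubit p \<theta> \<phi> $$ (0, 0) =
      of_real ((1 - p) / 2) + of_real p * (of_real (cos (\<theta> / 2)) * of_real (cos (\<theta> / 2)))"
    by (simp add: noisy_qubit_def ketbra_def bloch_ket_def)
  then show "noisy_qubit p \<theta> \<phi> $$ (0, 0) = of_real ((1 + p * cos \<theta>) / 2)"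
    unfolding c by (simp add: add_divide_distrib diff_divide_distrib algebra_simps)
  have "noisy_qubit p \<theta> \<phi> $$ (Suc 0, Suc 0) =
      of_real ((1 - p) / 2) + of_real p * ((exp (\<i> * of_real \<phi>) * cnj (exp (\<i> * of_real \<phi>))) *
        (of_real (sin (\<theta> / 2)) * of_real (sin (\<theta> / 2))))"
    by (simp add: noisy_qubit_def ketbra_def bloch_ket_def)
  then show "noisy_qubit p \<theta> \<phi> $$ (Suc 0, Suc 0) = of_real ((1 - p * cos \<theta>) / 2)"
    unfolding phase s by (simp add: add_divide_distrib diff_divide_distrib algebra_simps)
qed

text \<open>This is the state with Bloch vector \<open>(0, 0, D)\<close>, that is, the diagonal
  matrix with entries \<open>(1 + D) / 2\<close> and \<open>(1 - D) / 2\<close>, conjugated by the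
  rotation. The value \<open>True\<close> of \<open>a\<close> stands for the basis state 1.\<close>

definition rotated_state :: "real^3 \<Rightarrow> real \<Rightarrow> real \<Rightarrow> complex mat" where
  "rotated_state u \<alpha> D = Matrix.mat 2 2 (\<lambda>(x, y). \<Sum>a\<in>UNIV. of_real ((1 + (if a then - D else D)) / 2) *
      (qubit_rotation u \<alpha> $$ (x, of_bool a) * cnj (qubit_rotation u \<alpha> $$ (y, of_bool a))))"

text \<open>Column orthonormality is the form of unitarity that the partial trace consumes.\<close>

lemma qubit_rotation_columns:
  assumes "norm u = 1"
  shows "qubit_rotation u \<alpha> $$ (0, of_bool a) * cnj (qubit_rotation u \<alpha> $$ (0, of_bool b)) +
    qubit_rotation u \<alpha> $$ (1, of_bool a) * cnj (qubit_rotation u \<alpha> $$ (1, of_bool b)) = of_bool (a = b)"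
proof -
  have "(cos (\<alpha> / 2))\<^sup>2 + (sin (\<alpha> / 2))\<^sup>2 * ((u $ 1)\<^sup>2 + (u $ 2)\<^sup>2 + (u $ 3)\<^sup>2) = 1"
    unfolding norm_1_components[OF assms(1)] by simp
  then show ?thesis
    by (cases a; cases b)
      (simp_all add: qubit_rotation_index[OF assms] complex_eq_iff power2_eq_square algebra_simps)
qed

text \<open>Row orthonormality says that the rotation times its adjoint is the identity, which makes
  the state at \<open>D = 0\<close> maximally mixed.\<close>

lemma qubit_rotation_rows:
  assumes "norm u = 1" "x < 2" "y < 2"
  shows "(\<Sum>a\<in>UNIV. qubit_rotation u \<alpha> $$ (x, of_bool a) * cnj (qubit_rotation u \<alpha> $$ (y, of_bool a))) =
    of_bool (x = y)"
proof -
  have "(cos (\<alpha> / 2))\<^sup>2 + (sin (\<alpha> / 2))\<^sup>2 * ((u $ 1)\<^sup>2 + (u $ 2)\<^sup>2 + (u $ 3)\<^sup>2) = 1"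
    unfolding norm_1_components[OF assms(1)] by simp
  moreover have "x = 0 \<or> x = Suc 0" "y = 0 \<or> y = Suc 0"
    using assms by auto
  ultimately show ?thesis
    by (auto simp: UNIV_bool qubit_rotation_index[OF assms(1)] complex_eq_iff power2_eq_square algebra_simps)
qed

lemma bloch_xy_eq:
  assumes "M \<in> carrier_mat 2 2"
  shows "bloch_xy M = vector [Re (M $$ (1, 0) + M $$ (0, 1)), Im (M $$ (1, 0) - M $$ (0, 1))]"
  using assms
  by (simp add: bloch_xy_def bloch_vector_def mat_trace_def pauli_x_def pauli_y_def
      mat_of_rows_list_def scalar_prod_def numeral_2_eq_2)

text \<open>An instance of the covering of SO(3) by SU(2): conjugation by the qubit rotation turns
  the Bloch vector along the z-axis by \<open>rotate3\<close>. Only the two components that carry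
  the phase are compared.\<close>

lemma bloch_xy_rotated_state:
  assumes "norm u = 1"
  shows "bloch_xy (rotated_state u \<alpha> D) =
    D *\<^sub>R vector [rotate3 u \<alpha> (axis 3 1) $ 1, rotate3 u \<alpha> (axis 3 1) $ 2]"
proof -
  have "rotated_state u \<alpha> D \<in> carrier_mat 2 2"
    by (simp add: rotated_state_def)
  then show ?thesis
    by (simp add: bloch_xy_eq Finite_Cartesian_Product.vec_eq_iff forall_2 rotate3_e3 rotated_state_def UNIV_bool
        qubit_rotation_index[OF assms] field_simps)
qed

lemma rotated_state_zero:
  assumes "norm u = 1"
  shows "rotated_state u \<alpha> 0 = (1 / 2) \<cdot>\<^sub>m 1\<^sub>m 2"
proof (rule eq_matI)
  fix x y assume "x < dim_row ((1 / 2 :: complex) \<cdot>\<^sub>m 1\<^sub>m 2)" "y < dim_col ((1 / 2 :: complex) \<cdot>\<^sub>m 1\<^sub>m 2)"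
  then have xy: "x < 2" "y < 2" by auto
  then have "rotated_state u \<alpha> 0 $$ (x, y) = 1 / 2 * (\<Sum>a\<in>UNIV. qubit_rotation u \<alpha> $$ (x, of_bool a) *
      cnj (qubit_rotation u \<alpha> $$ (y, of_bool a)))"
    by (auto simp: rotated_state_def sum_distrib_left intro!: sum.cong)
  then show "rotated_state u \<alpha> 0 $$ (x, y) = ((1 / 2) \<cdot>\<^sub>m 1\<^sub>m 2) $$ (x, y)"
    using xy by (simp add: qubit_rotation_rows[OF assms])
qed (auto simp: rotated_state_def)

theorem mainTheorem1:
  fixes n :: nat and p \<theta>\<^sub>1 \<phi>\<^sub>1 \<alpha> :: real and u :: "real^3" and U \<rho>' :: "complex mat"
  assumes "n \<ge> 2"
    and "0 \<le> p" and "p \<le> 1"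
    and "\<theta>\<^sub>1 \<in> {0..pi}" and "\<phi>\<^sub>1 \<in> {0..2 * pi}"
    and "norm u = 1"
    and "rotate3 u \<alpha> (axis 3 1) \<notin> span {axis 3 1}"
    and U: "U = sync_unitary n u \<alpha>"
    and \<rho>': "\<rho>' = U * initial_state n p \<theta>\<^sub>1 \<phi>\<^sub>1 * mat_adjoint U"
  shows "(\<theta>\<^sub>1 = pi / 2 \<or> p = 0 \<longrightarrow>
           (\<forall>i\<in>{1..n}. reduced_state n i \<rho>' = (1 / 2) \<cdot>\<^sub>m 1\<^sub>m 2 \<and>
                       \<not> phase_defined (reduced_state n i \<rho>'))) \<and>
         (\<not> (\<theta>\<^sub>1 = pi / 2 \<or> p = 0) \<longrightarrow>
           (\<forall>i\<in>{1..n}. phase_defined (reduced_state n i \<rho>')) \<and>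
           (\<forall>i\<in>{2..n}. phase_fidelity (reduced_state n 1 \<rho>') (reduced_state n i \<rho>') = 1))"
proof -
  let ?D = "p * cos \<theta>\<^sub>1"
  let ?v = "vector [rotate3 u \<alpha> (axis 3 1) $ 1, rotate3 u \<alpha> (axis 3 1) $ 2] :: real^2"
  \<comment> \<open>The right-hand side does not mention \<open>i\<close>: all qubits end in the
    same state, which is the synchronization.\<close>
  have reduced: "reduced_state n i \<rho>' = rotated_state u \<alpha> ?D" if "i \<in> {1..n}" for i
  proof (rule eq_matI)
    fix x y assume "x < dim_row (rotated_state u \<alpha> ?D)" "y < dim_col (rotated_state u \<alpha> ?D)"
    then have xy: "x < 2" "y < 2"
      by (auto simp: rotated_state_def)
    have "reduced_state n i \<rho>' $$ (x, y) = (\<Sum>a\<in>UNIV. noisy_qubit p \<theta>\<^sub>1 \<phi>\<^sub>1 $$ (of_bool a, of_bool a) *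
        (qubit_rotation u \<alpha> $$ (x, of_bool a) * cnj (qubit_rotation u \<alpha> $$ (y, of_bool a))))"
      unfolding \<rho>' using that \<open>n \<ge> 2\<close> xy
      by (intro reduced_sync_state_index qubit_rotation_carrier qubit_rotation_columns \<open>norm u = 1\<close>)
        (auto simp: U sync_unitary_def)
    also have "\<dots> = rotated_state u \<alpha> ?D $$ (x, y)"
      using xy by (auto simp: rotated_state_def noisy_qubit_diagonal intro!: sum.cong)
    finally show "reduced_state n i \<rho>' $$ (x, y) = rotated_state u \<alpha> ?D $$ (x, y)" .
  qed (auto simp: reduced_state_def rotated_state_def)
  have bloch: "bloch_xy (reduced_state n i \<rho>') = ?D *\<^sub>R ?v" if "i \<in> {1..n}" for i
    using that \<open>norm u = 1\<close> by (simp add: reduced bloch_xy_rotated_state)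
  have D_zero: "?D = 0 \<longleftrightarrow> \<theta>\<^sub>1 = pi / 2 \<or> p = 0"
  proof -
    \<comment> \<open>Cosine is injective on \<open>{0..pi}\<close>, so \<open>pi / 2\<close> is its
      only zero there.\<close>
    have "\<theta>\<^sub>1 = pi / 2" if "cos \<theta>\<^sub>1 = 0"
      using that \<open>\<theta>\<^sub>1 \<in> {0..pi}\<close> cos_inj_pi[of \<theta>\<^sub>1 "pi / 2"] by auto
    then have "cos \<theta>\<^sub>1 = 0 \<longleftrightarrow> \<theta>\<^sub>1 = pi / 2"
      by (metis cos_pi_half)
    then show ?thesis by auto
  qed
  show ?thesis
  proof (intro conjI impI ballI)
    fix i assume "\<theta>\<^sub>1 = pi / 2 \<or> p = 0" and i: "i \<in> {1..n}"
    then have "?D = 0"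
      using D_zero by blast
    then show "reduced_state n i \<rho>' = (1 / 2) \<cdot>\<^sub>m 1\<^sub>m 2" "\<not> phase_defined (reduced_state n i \<rho>')"
      using reduced[OF i] bloch[OF i] rotated_state_zero[OF \<open>norm u = 1\<close>, of \<alpha>]
      by (simp_all only: phase_defined_def scaleR_zero_left simp_thms)
  next
    assume "\<not> (\<theta>\<^sub>1 = pi / 2 \<or> p = 0)"
    then have "?D \<noteq> 0"
      using D_zero by blast
    moreover have "?v \<noteq> 0"
      using rotate3_e3_off_axis[OF assms(7)]
      by (auto simp: Finite_Cartesian_Product.vec_eq_iff forall_2)
    ultimately have nz: "?D *\<^sub>R ?v \<noteq> 0" by simp
    {
      fix i assume "i \<in> {1..n}"
      with nz bloch show "phase_defined (reduced_state n i \<rho>')"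
        by (simp only: phase_defined_def simp_thms)
    next
      fix i assume "i \<in> {2..n}"
      then have "bloch_xy (reduced_state n i \<rho>') = ?D *\<^sub>R ?v" "bloch_xy (reduced_state n 1 \<rho>') = ?D *\<^sub>R ?v"
        by (auto intro!: bloch simp del: vector_2)
      \<comment> \<open>Both planar vectors are the same nonzero vector, so the quotient is its
        squared norm over itself. A negative \<open>?D\<close> reverses all qubits alike.\<close>
      then show "phase_fidelity (reduced_state n 1 \<rho>') (reduced_state n i \<rho>') = 1"
        using nz by (simp only: phase_fidelity_def) (simp add: dot_square_norm power2_eq_square)
    }
  qed
qed

end
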